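(* Let $\ell\colon\hat{\mathcal Y}\times\mathcal Y\to\mathbb R_{\ge0}$ be a target loss and $L\colon\mathbb R^d\times\mathcal Y\to\mathbb R_{\ge 0}$ a surrogate loss, convex in its first argument. Let $\alpha\in(0,1)$, and let $\boldsymbol\pi\colon\mathbb R^d\to\triangle^N$ be a decoding distribution map such that $$\mathbb E_{\hat y\sim\boldsymbol\pi(\boldsymbol\theta)}[\ell(\hat y,y)]\le(1-\alpha)L(\boldsymbol\theta,y)\quad\text{for all }\boldsymbol\theta\in\mathbb R^d,\ y\in\mathcal Y.$$ Let $(\boldsymbol x_t,y_t)_{t=1}^T$ be a sequence of inputs and labels, and let $L_t(\boldsymbol W)=L(\boldsymbol W\boldsymbol x_t,y_t)$ for $\boldsymbol W\in\mathcal W$. Let $M>0$ be such that for every $t\in[T]$ and $\boldsymbol W\in\mathcal W$ there is a chosen subgradient $\boldsymbol G_t(\boldsymbol W)\in\partial L_t(\boldsymbol W)$ with $\|\boldsymbol G_t(\boldsymbol W)\|_{\mathrm F}^2\le 2M L_t(\boldsymbol W)$. For $t=1,\dots,T$, compute $\boldsymbol W_t\in\mathcal W$ by online gradient descent: $\boldsymbol W_1\in\mathcal W$ is arbitrary and $$\boldsymbol W_{t+1}=\arg\min\{\|\boldsymbol W_t-\eta_t\boldsymbol G_t-\boldsymbol W\|_{\mathrm F}:\boldsymbol W\in\mathcal W\},\qquad \boldsymbol G_t=\boldsymbol G_t(\boldsymbol W_t),$$ with a non-increasing sequence of learning rates $\eta_1\ge\eta_2\ge\dots\ge\eta_T$ such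 that, for every $t$, with $\boldsymbol\theta_t=\boldsymbol W_t\boldsymbol x_t$, $$\frac{\alpha}{M}\le\eta_t\le\frac{2\left(L_t(\boldsymbol W_t)-\mathbb E_{\hat y_t\sim\boldsymbol\pi(\boldsymbol\theta_t)}[\ell(\hat y_t,y_t)]\right)}{\|\boldsymbol G_t\|_{\mathrm F}^2},$$ where the upper bound is interpreted as $+\infty$ when $\|\boldsymbol G_t\|_{\mathrm F}=0$. Then, for every $t$, the set of real numbers $\eta$ satisfying $\frac{\alpha}{M}\le\eta\le\frac{2\left(L_t(\boldsymbol W_t)-\mathbb E_{\hat y_t\sim\boldsymbol\pi(\boldsymbol\theta_t)}[\ell(\hat y_t,y_t)]\right)}{\|\boldsymbol G_t\|_{\mathrm F}^2}$ (with the upper bound read as $+\infty$ when $\|\boldsymbol G_t\|_{\mathrm F}=0$) is non-empty, and for any $\boldsymbol U_1,\dots,\boldsymbol U_T\in\mathcal W$, with $P_T=\sum_{t=2}^T\|\boldsymbol U_t-\boldsymbol U_{t-1}\|_{\mathrm F}$ and $F_T=\sum_{t=1}^T L_t(\boldsymbol U_t)$, we have $$\sum_{t=1}^T\mathbb E_{\hat y_t\sim\boldsymbol\pi(\boldsymbol\theta_t)}[\ell(\hat y_t,y_t)]\le F_T+\frac{MD}{\alpha}\left(\frac D2+P_T\right).$$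
   Context: $\mathcal Y=[K]$ and $\hat{\mathcal Y}=[N]$ are finite sets of labels and predictions; $\triangle^N$ is the probability simplex over $\hat{\mathcal Y}$. The target loss satisfies $\min_{\hat y\in\hat{\mathcal Y}}\ell(\hat y,y)=0$ for every $y\in\mathcal Y$. Inputs are vectors $\boldsymbol x_t\in\mathbb R^m$ with $\|\boldsymbol x_t\|_2\le1$. $\mathcal W\subseteq\mathbb R^{d\times m}$ is a non-empty closed convex set of linear estimators, and $D>0$ satisfies $\|\boldsymbol W-\boldsymbol W'\|_{\mathrm F}\le D$ for all $\boldsymbol W,\boldsymbol W'\in\mathcal W$, where $\|\cdot\|_{\mathrm F}$ is the Frobenius norm. The sequence $(\boldsymbol x_t,y_t)$ is arbitrary (possibly chosen adversarially based on past rounds); the expectation $\mathbb E_{\hat y_t\sim\boldsymbol\pi(\boldsymbol\theta_t)}$ is only over the draw of $\hat y_t$ from the distribution $\boldsymbol\pi(\boldsymbol\theta_t)$ on $\hat{\mathcal Y}$, with $\boldsymbol\theta_t$ and $y_t$ given. $\partial L_t(\boldsymbol W)$ is the set of subgradients of the convex function $L_t\colon\mathcal W\to\mathbb R$ at $\boldsymbol W$, i.e. matrices $\boldsymbol G$ with $L_t(\boldsymbol V)\ge L_t(\boldsymbol W)+\langle\boldsymbol G,\boldsymbol V-\boldsymbol W\rangle$ for all $\boldsymbol V\in\mathcal W$. *)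

theory Defs
  imports "HOL-Analysis.Analysis" "HOL-Probability.Probability"
begin

text \<open>Matrices in \<open>\<real>\<^sup>d\<^sup>\<times>\<^sup>m\<close> have type \<open>real ^ 'm ^ 'd\<close>; the library norm and inner product on this
  type are the Frobenius ones:\<close>

lemma norm_matrix_frobenius:
  fixes A :: "real ^ 'm ^ 'd"
  shows "norm A = sqrt (\<Sum>i\<in>UNIV. \<Sum>j\<in>UNIV. (A $ i $ j)\<^sup>2)"
  by (simp add: norm_vec_def L2_set_def sum_nonneg)

lemma inner_matrix_frobenius:
  fixes A B :: "real ^ 'm ^ 'd"
  shows "A \<bullet> B = (\<Sum>i\<in>UNIV. \<Sum>j\<in>UNIV. A $ i $ j * B $ i $ j)"
  by (simp add: inner_vec_def)

definition subdifferential_on :: "'a::real_inner set \<Rightarrow> ('a \<Rightarrow> real) \<Rightarrow> 'a \<Rightarrow> 'a set" where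
  "subdifferential_on S f w = {g. \<forall>v\<in>S. f v \<ge> f w + g \<bullet> (v - w)}"

definition round_loss ::
  "(real ^ 'd \<Rightarrow> 'y \<Rightarrow> real) \<Rightarrow> (nat \<Rightarrow> real ^ 'm) \<Rightarrow> (nat \<Rightarrow> 'y) \<Rightarrow> nat \<Rightarrow> real ^ 'm ^ 'd \<Rightarrow> real" where
  "round_loss L x y t W = L (W *v x t) (y t)"

definition expected_target ::
  "('p \<Rightarrow> 'y \<Rightarrow> real) \<Rightarrow> (real ^ 'd \<Rightarrow> 'p pmf) \<Rightarrow> real ^ 'd \<Rightarrow> 'y \<Rightarrow> real" where
  "expected_target l \<pi> \<theta> y = measure_pmf.expectation (\<pi> \<theta>) (\<lambda>p. l p y)"

text \<open>\<open>s\<close> is the surrogate loss of the round, \<open>e\<close> the expected target loss and \<open>g\<close> the norm of the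
  subgradient.\<close>

definition rate_upper_bound :: "real \<Rightarrow> real \<Rightarrow> real \<Rightarrow> ereal" where
  "rate_upper_bound s e g = (if g = 0 then \<infinity> else ereal (2 * (s - e) / g\<^sup>2))"

definition admissible_rates :: "real \<Rightarrow> real \<Rightarrow> real \<Rightarrow> real \<Rightarrow> real \<Rightarrow> real set" where
  "admissible_rates \<alpha> M s e g = {\<eta>. \<alpha> / M \<le> \<eta> \<and> ereal \<eta> \<le> rate_upper_bound s e g}"

text \<open>Projected online gradient descent over rounds \<open>1, \<dots>, T\<close>; it imposes no condition on the
  learning rates \<open>\<eta>\<close>.\<close>

definition ogd_run ::
  "nat \<Rightarrow> 'a::real_normed_vector set \<Rightarrow> (nat \<Rightarrow> 'a \<Rightarrow> 'a) \<Rightarrow> (nat \<Rightarrow> real) \<Rightarrow> (nat \<Rightarrow> 'a) \<Rightarrow> bool" where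
  "ogd_run T S G \<eta> W \<longleftrightarrow> W 1 \<in> S \<and>
     (\<forall>t\<in>{1..<T}. is_arg_min (\<lambda>V. norm (W t - \<eta> t *\<^sub>R G t (W t) - V)) (\<lambda>V. V \<in> S) (W (t + 1)))"

end

theory Submission
  imports Defs
begin

text \<open>The upper bound on the learning rate makes \<open>\<eta>\<^sub>t \<parallel>G\<^sub>t\<parallel>\<^sup>2 / 2\<close>, the second-order term of
  the gradient descent inequality, at most the gap between the surrogate loss and the expected target
  loss. Hence each round costs at most the comparator's loss plus
  \<open>(\<parallel>W\<^sub>t - U\<^sub>t\<parallel>\<^sup>2 - \<parallel>W\<^sub>t\<^sub>+\<^sub>1 - U\<^sub>t\<parallel>\<^sup>2) / (2 \<eta>\<^sub>t)\<close>. Since the rates are non-increasing and bounded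
  below by \<open>\<alpha> / M\<close>, these terms telescope up to the drift of the comparators, which contributes
  \<open>D \<parallel>U\<^sub>t - U\<^sub>t\<^sub>-\<^sub>1\<parallel> / \<eta>\<^sub>t\<close> per round.\<close>

text \<open>The projection \<open>p\<close> sees \<open>z\<close> and any \<open>u\<close> in the
  convex set at an angle of at least 90 degrees, so expanding \<open>norm (z - u)\<close> squared
  around \<open>p\<close> adds only nonnegative terms to \<open>norm (p - u)\<close>
  squared.\<close>

lemma norm_arg_min_projection_le:
  fixes S :: "'a::euclidean_space set"
  assumes "convex S" "closed S" "is_arg_min (\<lambda>v. norm (z - v)) (\<lambda>v. v \<in> S) p" "u \<in> S"
  shows "norm (p - u) \<le> norm (z - u)"
proof -
  have p: "p \<in> S" "\<forall>v\<in>S. dist z p \<le> dist z v"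
    using assms(3) by (auto simp: is_arg_min_linorder dist_norm)
  have "(z - p) \<bullet> (u - p) \<le> 0"
    using any_closest_point_dot[OF assms(1,2) p(1) assms(4) p(2)] .
  moreover have "(norm (z - u))\<^sup>2 = (norm (p - u))\<^sup>2 + (norm (z - p))\<^sup>2 - 2 * ((z - p) \<bullet> (u - p))"
    by (simp add: power2_norm_eq_inner inner_diff_left inner_diff_right inner_commute)
  ultimately have "(norm (p - u))\<^sup>2 \<le> (norm (z - u))\<^sup>2"
    using zero_le_power2[of "norm (z - p)"] by linarith
  then show ?thesis
    by (rule power2_le_imp_le) simp
qed

text \<open>Expand the square of the unprojected step and solve for the inner product. The point
  \<open>v\<close> need only be as close to \<open>u\<close> as that step is, which covers both a
  projected iterate and \<open>u\<close> itself.\<close>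

lemma gradient_step_inner_le:
  fixes g w v u :: "'a::real_inner"
  assumes "0 < \<eta>" "norm (v - u) \<le> norm (w - \<eta> *\<^sub>R g - u)"
  shows "g \<bullet> (w - u) \<le> ((norm (w - u))\<^sup>2 - (norm (v - u))\<^sup>2) / (2 * \<eta>) + \<eta> / 2 * (norm g)\<^sup>2"
proof -
  have "(norm (v - u))\<^sup>2 \<le> (norm (w - \<eta> *\<^sub>R g - u))\<^sup>2"
    using assms(2) by (intro power_mono) auto
  also have "\<dots> = (norm (w - u))\<^sup>2 - 2 * \<eta> * (g \<bullet> (w - u)) + \<eta>\<^sup>2 * (norm g)\<^sup>2"
    unfolding power2_norm_eq_inner
    by (simp add: inner_diff_left inner_diff_right inner_commute algebra_simps power2_eq_square)
  finally have "2 * \<eta> * (g \<bullet> (w - u))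
      \<le> (norm (w - u))\<^sup>2 - (norm (v - u))\<^sup>2 + \<eta>\<^sup>2 * (norm g)\<^sup>2"
    by linarith
  then show ?thesis
    using assms(1) by (simp add: field_simps power2_eq_square)
qed

text \<open>Summation by parts for squared distances to the comparator before (\<open>a t\<close>)
  and after (\<open>b t\<close>) the step of round \<open>t\<close>. The term
  \<open>(B - b n) / (2 * \<eta> n)\<close> is the invariant that carries the induction: its
  \<open>- b n\<close> is what cancels against the next round.\<close>

lemma sum_weighted_telescope_le:
  fixes a b p \<eta> :: "nat \<Rightarrow> real"
  assumes "0 < c" "0 \<le> K"
    and "1 \<le> n"
    and rate: "\<And>t. t \<in> {1..n} \<Longrightarrow> c \<le> \<eta> t"
    and anti: "\<And>t. t \<in> {1..<n} \<Longrightarrow> \<eta> (t + 1) \<le> \<eta> t"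
    and init: "a 1 \<le> B"
    and bound: "\<And>t. t \<in> {1..<n} \<Longrightarrow> b t \<le> B"
    and drift_nonneg: "\<And>t. t \<in> {2..n} \<Longrightarrow> 0 \<le> p t"
    and drift: "\<And>t. t \<in> {1..<n} \<Longrightarrow> a (t + 1) - b t \<le> 2 * K * p (t + 1)"
  shows "(\<Sum>t=1..n. (a t - b t) / (2 * \<eta> t)) \<le> (B - b n) / (2 * \<eta> n) + K / c * (\<Sum>t=2..n. p t)"
  using \<open>1 \<le> n\<close> rate anti bound drift_nonneg drift
proof (induction n rule: dec_induct)
  case base
  then show ?case
    using init \<open>0 < c\<close> by (force intro!: divide_right_mono)
next
  case (step n)
  let ?e = "\<eta> n" and ?f = "\<eta> (Suc n)"
  have f: "c \<le> ?f" "?f \<le> ?e" and b: "b n \<le> B" and p: "0 \<le> p (Suc n)"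
    and a: "a (Suc n) \<le> b n + 2 * K * p (Suc n)"
    using step.hyps step.prems(1)[of "Suc n"] step.prems(2)[of n] step.prems(3)[of n]
      step.prems(4)[of "Suc n"] step.prems(5)[of n] by auto
  have "(\<Sum>t=1..n. (a t - b t) / (2 * \<eta> t)) \<le> (B - b n) / (2 * ?e) + K / c * (\<Sum>t=2..n. p t)"
    using step.prems by (intro step.IH) auto
  \<comment> \<open>The numerator is nonnegative, so passing to the next, smaller rate can only
    increase the carried term; both fractions then share a denominator and \<open>b n\<close>
    cancels.\<close>
  moreover have "(B - b n) / (2 * ?e) \<le> (B - b n) / (2 * ?f)"
    using b f \<open>0 < c\<close> by (intro divide_left_mono mult_pos_pos) auto
  moreover have "(a (Suc n) - b (Suc n)) / (2 * ?f)
      \<le> (b n + 2 * K * p (Suc n) - b (Suc n)) / (2 * ?f)"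
    using a f \<open>0 < c\<close> by (intro divide_right_mono) auto
  moreover have "(B - b n) / (2 * ?f) + (b n + 2 * K * p (Suc n) - b (Suc n)) / (2 * ?f)
      = (B - b (Suc n)) / (2 * ?f) + K * p (Suc n) / ?f"
    using f \<open>0 < c\<close> by (simp add: field_simps)
  moreover have "K * p (Suc n) / ?f \<le> K / c * p (Suc n)"
    using p f \<open>0 < c\<close> \<open>0 \<le> K\<close> divide_left_mono[of c ?f "K * p (Suc n)"] by simp
  ultimately show ?case
    using step.hyps by (simp add: distrib_left)
qed

text \<open>The decoding condition leaves a gap \<open>s - e\<close> of at least
  \<open>\<alpha> * s\<close>, and the self-bounding property of the subgradient gives
  \<open>s\<close> at least \<open>g\<^sup>2 / (2 * M)\<close>; together they put the lower bound
  below the upper one.\<close>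

lemma min_rate_admissible:
  assumes "0 < M" "0 \<le> \<alpha>" "e \<le> (1 - \<alpha>) * s" "g\<^sup>2 \<le> 2 * M * s"
  shows "\<alpha> / M \<in> admissible_rates \<alpha> M s e g"
proof -
  have "\<alpha> / M \<le> 2 * (s - e) / g\<^sup>2" if "g \<noteq> 0"
  proof -
    have "\<alpha> * g\<^sup>2 \<le> \<alpha> * (2 * M * s)"
      using assms by (intro mult_left_mono)
    also have "\<dots> = 2 * M * (\<alpha> * s)"
      by simp
    also have "\<dots> \<le> 2 * M * (s - e)"
      using assms by (intro mult_left_mono) (auto simp: algebra_simps)
    finally show ?thesis
      using that \<open>0 < M\<close> by (simp add: field_simps)
  qed
  then show ?thesis
    by (simp add: admissible_rates_def rate_upper_bound_def)
qed

text \<open>For nonzero \<open>g\<close> this is the upper bound with its denominator cleared. For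
  \<open>g = 0\<close> that bound is infinite and the claim reduces to
  \<open>e \<le> s\<close>.\<close>

lemma admissible_rate_gap:
  assumes "\<eta> \<in> admissible_rates \<alpha> M s e g" "e \<le> s"
  shows "\<eta> / 2 * g\<^sup>2 \<le> s - e"
  using assms by (cases "g = 0") (auto simp: admissible_rates_def rate_upper_bound_def field_simps)

lemma ogd_run_mem:
  assumes "ogd_run T S G \<eta> W" "t \<in> {1..T}"
  shows "W t \<in> S"
proof (cases "t = 1")
  case True
  then show ?thesis using assms(1) by (simp add: ogd_run_def)
next
  case False
  then have "t - 1 \<in> {1..<T}" "t - 1 + 1 = t"
    using assms(2) by auto
  then show ?thesis
    using assms(1) unfolding ogd_run_def is_arg_min_def by metis
qed

text \<open>No iterate \<open>W (T + 1)\<close> is available, so in the last round the comparator \<open>U T\<close>, at distance \<open>0\<close>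
  from itself, takes its place.\<close>

lemma ogd_dynamic_regret_le:
  fixes W U :: "nat \<Rightarrow> 'a::euclidean_space"
  assumes "convex S" "closed S"
    and run: "ogd_run T S G \<eta> W"
    and diameter: "\<And>v v'. v \<in> S \<Longrightarrow> v' \<in> S \<Longrightarrow> norm (v - v') \<le> D"
    and "0 < c" "0 \<le> D"
    and rate: "\<And>t. t \<in> {1..T} \<Longrightarrow> c \<le> \<eta> t"
    and anti: "\<And>t. t \<in> {1..<T} \<Longrightarrow> \<eta> (t + 1) \<le> \<eta> t"
    and U: "\<And>t. t \<in> {1..T} \<Longrightarrow> U t \<in> S"
  shows "(\<Sum>t=1..T. G t (W t) \<bullet> (W t - U t) - \<eta> t / 2 * (norm (G t (W t)))\<^sup>2)
    \<le> D / c * (D / 2 + (\<Sum>t=2..T. norm (U t - U (t - 1))))"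
proof (cases "T = 0")
  case True
  then show ?thesis
    using \<open>0 < c\<close> \<open>0 \<le> D\<close> by simp
next
  case False
  define V where "V t = (if t < T then W (t + 1) else U T)" for t
  let ?a = "\<lambda>t. (norm (W t - U t))\<^sup>2" and ?b = "\<lambda>t. (norm (V t - U t))\<^sup>2"
  have step_min: "is_arg_min (\<lambda>v. norm (W t - \<eta> t *\<^sub>R G t (W t) - v)) (\<lambda>v. v \<in> S) (W (t + 1))"
    if "t \<in> {1..<T}" for t
    using run that by (simp add: ogd_run_def)
  have W: "W t \<in> S" if "t \<in> {1..T}" for t
    using ogd_run_mem[OF run that] .
  have dist_sq: "(norm (v - v'))\<^sup>2 \<le> D\<^sup>2" if "v \<in> S" "v' \<in> S" for v v'
    using diameter[OF that] by (intro power_mono) auto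
  have "(\<Sum>t=1..T. G t (W t) \<bullet> (W t - U t) - \<eta> t / 2 * (norm (G t (W t)))\<^sup>2)
      \<le> (\<Sum>t=1..T. (?a t - ?b t) / (2 * \<eta> t))"
  proof (rule sum_mono)
    fix t assume t: "t \<in> {1..T}"
    have "norm (V t - U t) \<le> norm (W t - \<eta> t *\<^sub>R G t (W t) - U t)"
    proof (cases "t < T")
      case True
      then show ?thesis
        using norm_arg_min_projection_le[OF assms(1,2) step_min U[OF t]] t by (simp add: V_def)
    next
      case False
      then show ?thesis using t by (simp add: V_def)
    qed
    from gradient_step_inner_le[OF _ this] rate[OF t] \<open>0 < c\<close>
    show "G t (W t) \<bullet> (W t - U t) - \<eta> t / 2 * (norm (G t (W t)))\<^sup>2 \<le> (?a t - ?b t) / (2 * \<eta> t)"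
      by simp
  qed
  \<comment> \<open>The telescoping lemma is used with \<open>B = D\<^sup>2\<close> and
    \<open>K = D\<close>; the drift is the comparator's movement.\<close>
  also have "\<dots> \<le> (D\<^sup>2 - ?b T) / (2 * \<eta> T) + D / c * (\<Sum>t=2..T. norm (U t - U (t - 1)))"
  proof (rule sum_weighted_telescope_le)
    fix t assume t: "t \<in> {1..<T}"
    let ?r = "norm (W (t + 1) - U (t + 1))" and ?s = "norm (W (t + 1) - U t)"
      and ?p = "norm (U (t + 1) - U t)"
    have mem: "W (t + 1) \<in> S" "U (t + 1) \<in> S" "U t \<in> S"
      using t by (auto intro: W U)
    show "?b t \<le> D\<^sup>2"
      using t mem dist_sq by (simp add: V_def)
    have "?r - ?s \<le> ?p"
      using norm_triangle_ineq2[of "W (t + 1) - U (t + 1)" "W (t + 1) - U t"]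
      by (simp add: norm_minus_commute)
    \<comment> \<open>A difference of squared distances factors: the first factor is at most the
      comparator's movement, the second at most twice the diameter.\<close>
    then have "(?r - ?s) * (?r + ?s) \<le> ?p * (?r + ?s)"
      by (intro mult_right_mono) auto
    also have "\<dots> \<le> ?p * (2 * D)"
      using diameter[OF mem(1,2)] diameter[OF mem(1,3)] by (intro mult_left_mono) auto
    finally show "?a (t + 1) - ?b t \<le> 2 * D * norm (U (t + 1) - U (t + 1 - 1))"
      using t by (simp add: V_def power2_eq_square algebra_simps)
  qed (use False assms dist_sq W U in auto)
  \<comment> \<open>Since \<open>V T = U T\<close>, the term \<open>?b T\<close> vanishes, and the
    last rate is at least \<open>c\<close>.\<close>
  also have "(D\<^sup>2 - ?b T) / (2 * \<eta> T) \<le> D\<^sup>2 / (2 * c)"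
    using False rate[of T] \<open>0 < c\<close> by (auto simp: V_def intro!: divide_left_mono)
  finally show ?thesis
    by (simp add: power2_eq_square algebra_simps)
qed

theorem theorem3p4:
  fixes l :: "'p::finite \<Rightarrow> 'y::finite \<Rightarrow> real"
    and L :: "real ^ 'd \<Rightarrow> 'y \<Rightarrow> real"
    and \<pi> :: "real ^ 'd \<Rightarrow> 'p pmf"
    and \<W> :: "(real ^ 'm ^ 'd) set"
    and x :: "nat \<Rightarrow> real ^ 'm"
    and y :: "nat \<Rightarrow> 'y"
    and G :: "nat \<Rightarrow> real ^ 'm ^ 'd \<Rightarrow> real ^ 'm ^ 'd"
    and W :: "nat \<Rightarrow> real ^ 'm ^ 'd"
    and \<eta> :: "nat \<Rightarrow> real"
    and \<alpha> M D :: real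
    and T :: nat
  assumes target_nonneg: "\<And>p c. l p c \<ge> 0"
    and target_min: "\<And>c. (MIN p. l p c) = 0"
    and surrogate_nonneg: "\<And>\<theta> c. L \<theta> c \<ge> 0"
    and surrogate_convex: "\<And>c. convex_on UNIV (\<lambda>\<theta>. L \<theta> c)"
    and alpha: "0 < \<alpha>" "\<alpha> < 1"
    and decoding: "\<And>\<theta> c. expected_target l \<pi> \<theta> c \<le> (1 - \<alpha>) * L \<theta> c"
    and estimators: "\<W> \<noteq> {}" "closed \<W>" "convex \<W>"
    and D_pos: "D > 0"
    and diameter: "\<And>V V'. V \<in> \<W> \<Longrightarrow> V' \<in> \<W> \<Longrightarrow> norm (V - V') \<le> D"
    and inputs: "\<And>t. t \<in> {1..T} \<Longrightarrow> norm (x t) \<le> 1"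
    and M_pos: "M > 0"
    and subgradient: "\<And>t V. t \<in> {1..T} \<Longrightarrow> V \<in> \<W> \<Longrightarrow>
          G t V \<in> subdifferential_on \<W> (round_loss L x y t) V"
    and subgradient_bound: "\<And>t V. t \<in> {1..T} \<Longrightarrow> V \<in> \<W> \<Longrightarrow>
          (norm (G t V))\<^sup>2 \<le> 2 * M * round_loss L x y t V"
    and ogd: "ogd_run T \<W> G \<eta> W"
  shows "(\<forall>t\<in>{1..T}.
            admissible_rates \<alpha> M (round_loss L x y t (W t))
              (expected_target l \<pi> (W t *v x t) (y t)) (norm (G t (W t))) \<noteq> {})
       \<and> ((\<forall>t\<in>{1..<T}. \<eta> (t + 1) \<le> \<eta> t) \<longrightarrow>
          (\<forall>t\<in>{1..T}.
            \<eta> t \<in> admissible_rates \<alpha> M (round_loss L x y t (W t))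
              (expected_target l \<pi> (W t *v x t) (y t)) (norm (G t (W t)))) \<longrightarrow>
          (\<forall>U. (\<forall>t\<in>{1..T}. U t \<in> \<W>) \<longrightarrow>
            (\<Sum>t=1..T. expected_target l \<pi> (W t *v x t) (y t))
              \<le> (\<Sum>t=1..T. round_loss L x y t (U t))
                + M * D / \<alpha> * (D / 2 + (\<Sum>t=2..T. norm (U t - U (t - 1))))))"
proof (intro conjI impI allI ballI)
  let ?s = "\<lambda>t. round_loss L x y t (W t)"
  let ?e = "\<lambda>t. expected_target l \<pi> (W t *v x t) (y t)"
  let ?g = "\<lambda>t. norm (G t (W t))"
  have W: "W t \<in> \<W>" if "t \<in> {1..T}" for t
    using ogd_run_mem[OF ogd that] .
  have gap: "?e t \<le> (1 - \<alpha>) * ?s t" for t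
    using decoding by (simp add: round_loss_def)
  {
    fix t assume t: "t \<in> {1..T}"
    have "\<alpha> / M \<in> admissible_rates \<alpha> M (?s t) (?e t) (?g t)"
      using M_pos alpha gap subgradient_bound[OF t W[OF t]]
      by (intro min_rate_admissible) auto
    then show "admissible_rates \<alpha> M (?s t) (?e t) (?g t) \<noteq> {}"
      by blast
  }
  fix U
  assume anti: "\<forall>t\<in>{1..<T}. \<eta> (t + 1) \<le> \<eta> t"
    and rates: "\<forall>t\<in>{1..T}. \<eta> t \<in> admissible_rates \<alpha> M (?s t) (?e t) (?g t)"
    and U: "\<forall>t\<in>{1..T}. U t \<in> \<W>"
  have "?e t - round_loss L x y t (U t) \<le> G t (W t) \<bullet> (W t - U t) - \<eta> t / 2 * (?g t)\<^sup>2"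
    if t: "t \<in> {1..T}" for t
  proof -
    \<comment> \<open>Nonnegativity of the surrogate weakens the decoding condition to
      \<open>?e t \<le> ?s t\<close>, which rounds with zero subgradient rely on.\<close>
    have "0 \<le> \<alpha> * ?s t"
      using alpha surrogate_nonneg by (simp add: round_loss_def)
    then have "?e t \<le> ?s t"
      using gap[of t] by (simp add: algebra_simps)
    then have "\<eta> t / 2 * (?g t)\<^sup>2 \<le> ?s t - ?e t"
      using rates t by (intro admissible_rate_gap) auto
    moreover have "round_loss L x y t (U t) \<ge> ?s t + G t (W t) \<bullet> (U t - W t)"
      using subgradient[OF t W[OF t]] U t by (simp add: subdifferential_on_def)
    ultimately show ?thesis
      by (simp add: inner_diff_right)
  qed
  then have "(\<Sum>t=1..T. ?e t - round_loss L x y t (U t))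
      \<le> (\<Sum>t=1..T. G t (W t) \<bullet> (W t - U t) - \<eta> t / 2 * (?g t)\<^sup>2)"
    by (rule sum_mono)
  \<comment> \<open>The regret bound is applied with \<open>c = \<alpha> / M\<close>, the common
    lower bound of the rates, which produces the factor \<open>M * D / \<alpha>\<close>.\<close>
  also have "\<dots> \<le> D / (\<alpha> / M) * (D / 2 + (\<Sum>t=2..T. norm (U t - U (t - 1))))"
    using estimators ogd diameter alpha M_pos D_pos rates anti U
    by (intro ogd_dynamic_regret_le) (auto simp: admissible_rates_def)
  finally show "(\<Sum>t=1..T. ?e t) \<le> (\<Sum>t=1..T. round_loss L x y t (U t))
      + M * D / \<alpha> * (D / 2 + (\<Sum>t=2..T. norm (U t - U (t - 1))))"
    by (simp add: sum_subtractf mult.commute)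
qed

end
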